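(* Let $(X_t)_{t\ge 0}$ be the real-valued process solving the stochastic differential equation $dX_t = a(X_t,t)\,dt + \sigma(X_t,t)\,dW_t$, where $(W_t)_{t\ge0}$ is standard Brownian motion, $a(x,t)$ and $\sigma(x,t)>0$ are real-valued smooth functions, and let $b(x,t)=b_t(x)=\sigma(x,t)^2$. Let $p_t(x)=p(x,t)$ be the density of $X_t$, and assume the standing regularity assumptions listed in the context. Then for $t>0$ $$\frac{d}{dt} H(X_t) = \frac12 J_{b_t}(X_t) + \mathbb{E}\left[\frac{\partial a}{\partial x}(X_t,t) - \frac12 \frac{\partial^2 b}{\partial x^2}(X_t,t)\right].$$
   Context: Shannon entropy: $H(X)=-\int_{\mathbb{R}} p(x)\log p(x)\,dx$ for a random variable $X$ with density $p$. Generalized Fisher information with respect to a positive function $\beta:\mathbb{R}\to(0,\infty)$: $J_\beta(X)=\mathbb{E}\big[\beta(X)\big(\tfrac{\partial}{\partial x}\log p(X)\big)^2\big]=\int_{\mathbb{R}}\beta(x)\frac{p'(x)^2}{p(x)}\,dx$, where $p$ is the density of $X$. Standing regularity assumptions: $a$ and $\sigma$ satisfy regularity and growth conditions (e.g. smooth and Lipschitz) under which $X_t$ has a density $p(x,t)$ satisfying the Fokker-Planck equation $\frac{\partial p}{\partial t}=-\frac{\partial}{\partial x}(a p)+\frac12\frac{\partial^2}{\partial x^2}(b p)$. Densities are positive, smooth and rapidly decreasing, in the sense that all integrals involved converge, one may differentiate under the integral sign, and every integration by parts (involving products of $a$, $b$, densities, logarithms of densities, and their derivatives) has zero boundary terms.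 *)

theory Defs
  imports "HOL-Probability.Probability"
begin

section \<open>Smooth functions\<close>

text \<open>
  Intended for open \<open>S\<close>: all directional derivatives up to order \<open>n\<close> exist and are continuous on \<open>S\<close>.
\<close>

primrec Ck_on :: "nat \<Rightarrow> 'a::real_normed_vector set \<Rightarrow> ('a \<Rightarrow> 'b::real_normed_vector) \<Rightarrow> bool" where
  "Ck_on 0 S f \<longleftrightarrow> continuous_on S f"
| "Ck_on (Suc n) S f \<longleftrightarrow>
     (\<forall>x\<in>S. f differentiable (at x)) \<and>
     (\<forall>v. Ck_on n S (\<lambda>x. frechet_derivative f (at x) v))"

definition smooth_on :: "'a::real_normed_vector set \<Rightarrow> ('a \<Rightarrow> 'b::real_normed_vector) \<Rightarrow> bool" where
  "smooth_on S f \<longleftrightarrow> (\<forall>n. Ck_on n S f)"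


section \<open>Brownian motion, It\^o integral, stochastic differential equations\<close>

text \<open>
  Processes and filtrations are indexed by \<^typ>\<open>real\<close>, so that the library locale for
  filtrations applies; only times \<open>t \<ge> 0\<close> are relevant (a filtration on \<open>[0,\<infinity>)\<close> may be
  continued by \<open>F t = F 0\<close> for \<open>t < 0\<close>).
\<close>

definition brownian_motion ::
  "'a measure \<Rightarrow> (real \<Rightarrow> 'a measure) \<Rightarrow> (real \<Rightarrow> 'a \<Rightarrow> real) \<Rightarrow> bool" where
  "brownian_motion M F W \<longleftrightarrow>
     filtration (space M) F \<and> (\<forall>t. sets (F t) \<subseteq> sets M) \<and>
     (\<forall>t\<ge>0. W t \<in> borel_measurable (F t)) \<and>
     (AE \<omega> in M. W 0 \<omega> = 0) \<and>
     (AE \<omega> in M. continuous_on {0..} (\<lambda>t. W t \<omega>)) \<and>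
     (\<forall>s t. 0 \<le> s \<and> s < t \<longrightarrow>
        distributed M lborel (\<lambda>\<omega>. W t \<omega> - W s \<omega>) (normal_density 0 (sqrt (t - s))) \<and>
        prob_space.indep_set M (sets (F s))
          (sets (vimage_algebra (space M) (\<lambda>\<omega>. W t \<omega> - W s \<omega>) borel)))"

text \<open>
  The data \<open>n, \<tau>, \<xi>\<close> describe the simple integrand
  \<open>\<Sum>i<n. \<xi> i * indicator {\<tau> i<..\<tau> (i+1)}\<close>, where \<open>\<xi> i\<close> is bounded and known at time \<open>\<tau> i\<close>.
\<close>

definition simple_integrand ::
  "(real \<Rightarrow> 'a measure) \<Rightarrow> nat \<Rightarrow> (nat \<Rightarrow> real) \<Rightarrow> (nat \<Rightarrow> 'a \<Rightarrow> real) \<Rightarrow> bool" where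
  "simple_integrand F n \<tau> \<xi> \<longleftrightarrow>
     0 \<le> \<tau> 0 \<and> (\<forall>i<n. \<tau> i \<le> \<tau> (Suc i)) \<and>
     (\<forall>i<n. \<xi> i \<in> borel_measurable (F (\<tau> i)) \<and> (\<exists>C. \<forall>\<omega>\<in>space (F (\<tau> i)). \<bar>\<xi> i \<omega>\<bar> \<le> C))"

definition simple_process ::
  "nat \<Rightarrow> (nat \<Rightarrow> real) \<Rightarrow> (nat \<Rightarrow> 'a \<Rightarrow> real) \<Rightarrow> real \<Rightarrow> 'a \<Rightarrow> real" where
  "simple_process n \<tau> \<xi> s \<omega> = (\<Sum>i<n. \<xi> i \<omega> * indicator {\<tau> i<..\<tau> (Suc i)} s)"

definition simple_ito_integral ::
  "(real \<Rightarrow> 'a \<Rightarrow> real) \<Rightarrow> nat \<Rightarrow> (nat \<Rightarrow> real) \<Rightarrow> (nat \<Rightarrow> 'a \<Rightarrow> real) \<Rightarrow> real \<Rightarrow> 'a \<Rightarrow> real" where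
  "simple_ito_integral W n \<tau> \<xi> t \<omega> =
     (\<Sum>i<n. \<xi> i \<omega> * (W (min (\<tau> (Suc i)) t) \<omega> - W (min (\<tau> i) t) \<omega>))"

definition progressive :: "(real \<Rightarrow> 'a measure) \<Rightarrow> (real \<Rightarrow> 'a \<Rightarrow> real) \<Rightarrow> bool" where
  "progressive F H \<longleftrightarrow>
     (\<forall>T\<ge>0. (\<lambda>(s, \<omega>). H s \<omega>) \<in> borel_measurable (restrict_space borel {0..T} \<Otimes>\<^sub>M F T))"

text \<open>
  \<open>Y\<close> is a continuous version of \<open>t \<mapsto> \<integral>\<^sub>0\<^sup>t H dW\<close>: there are simple integrands \<open>H\<^sub>k\<close> with
  \<open>\<integral>\<^sub>0\<^sup>t (H\<^sub>k - H)\<^sup>2 ds \<rightarrow> 0\<close> in probability whose integrals at time \<open>t\<close> converge to \<open>Y t\<close> in probability,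
  for every \<open>t \<ge> 0\<close>. This is the integral for progressive \<open>H\<close> with \<open>\<integral>\<^sub>0\<^sup>t H\<^sup>2 ds < \<infinity>\<close> almost surely;
  it determines \<open>Y\<close> up to indistinguishability.
\<close>

definition ito_integral ::
  "'a measure \<Rightarrow> (real \<Rightarrow> 'a measure) \<Rightarrow> (real \<Rightarrow> 'a \<Rightarrow> real) \<Rightarrow> (real \<Rightarrow> 'a \<Rightarrow> real) \<Rightarrow>
     (real \<Rightarrow> 'a \<Rightarrow> real) \<Rightarrow> bool" where
  "ito_integral M F W H Y \<longleftrightarrow>
     progressive F H \<and>
     (\<forall>t\<ge>0. Y t \<in> borel_measurable M) \<and>
     (AE \<omega> in M. continuous_on {0..} (\<lambda>t. Y t \<omega>)) \<and>
     (\<exists>n \<tau> \<xi>. (\<forall>k. simple_integrand F (n k) (\<tau> k) (\<xi> k)) \<and>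
       (\<forall>t\<ge>0. \<forall>e>0.
          (\<lambda>k. measure M {\<omega> \<in> space M.
             ennreal e < (\<integral>\<^sup>+s\<in>{0..t}. ennreal ((simple_process (n k) (\<tau> k) (\<xi> k) s \<omega> - H s \<omega>)\<^sup>2) \<partial>lborel)})
            \<longlonglongrightarrow> 0 \<and>
          (\<lambda>k. measure M {\<omega> \<in> space M.
             e < \<bar>simple_ito_integral W (n k) (\<tau> k) (\<xi> k) t \<omega> - Y t \<omega>\<bar>})
            \<longlonglongrightarrow> 0))"

definition sde_solution ::
  "'a measure \<Rightarrow> (real \<Rightarrow> 'a measure) \<Rightarrow> (real \<Rightarrow> 'a \<Rightarrow> real) \<Rightarrow> (real \<Rightarrow> real \<Rightarrow> real) \<Rightarrow>
     (real \<Rightarrow> real \<Rightarrow> real) \<Rightarrow> (real \<Rightarrow> 'a \<Rightarrow> real) \<Rightarrow> bool" where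
  "sde_solution M F W a \<sigma> X \<longleftrightarrow>
     (\<forall>t\<ge>0. X t \<in> borel_measurable (F t)) \<and>
     (AE \<omega> in M. continuous_on {0..} (\<lambda>t. X t \<omega>)) \<and>
     (AE \<omega> in M. \<forall>t\<ge>0. set_integrable lborel {0..t} (\<lambda>s. a (X s \<omega>) s)) \<and>
     (\<exists>Y. ito_integral M F W (\<lambda>s \<omega>. \<sigma> (X s \<omega>) s) Y \<and>
        (AE \<omega> in M. \<forall>t\<ge>0. X t \<omega> = X 0 \<omega> + (LINT s:{0..t}|lborel. a (X s \<omega>) s) + Y t \<omega>))"


section \<open>Entropy and Fisher information\<close>

text \<open>
  Shannon entropy is the library constant \<^const>\<open>prob_space.entropy\<close>, taken with base \<open>e\<close> and
  with respect to Lebesgue measure; for a variable with density \<open>p\<close> it is the usual integral.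
\<close>

lemma (in prob_space) entropy_eq_integral_density:
  fixes X :: "'a \<Rightarrow> real" and p :: "real \<Rightarrow> real"
  assumes "distributed M lborel X (\<lambda>x. ennreal (p x))" and "\<And>x. 0 \<le> p x"
  shows "entropy (exp 1) lborel X = - (\<integral>x. p x * ln (p x) \<partial>lborel)"
proof -
  interpret information_space M "exp 1"
    by unfold_locales simp
  show ?thesis
    using entropy_distr[OF assms(1)] assms(2) by (simp add: log_def)
qed

text \<open>The density \<open>p\<close> of \<open>X\<close> is an explicit argument, to fix a differentiable version of it.\<close>

definition fisher_information ::
  "'a measure \<Rightarrow> (real \<Rightarrow> real) \<Rightarrow> (real \<Rightarrow> real) \<Rightarrow> ('a \<Rightarrow> real) \<Rightarrow> real" where
  "fisher_information M \<beta> p X = (\<integral>\<omega>. \<beta> (X \<omega>) * (deriv (\<lambda>x. ln (p x)) (X \<omega>))\<^sup>2 \<partial>M)"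


section \<open>Regularity of the densities\<close>

definition fokker_planck ::
  "(real \<Rightarrow> real \<Rightarrow> real) \<Rightarrow> (real \<Rightarrow> real \<Rightarrow> real) \<Rightarrow> (real \<Rightarrow> real \<Rightarrow> real) \<Rightarrow> bool" where
  "fokker_planck a b p \<longleftrightarrow>
     (\<forall>x. \<forall>t>0. ((\<lambda>s. p x s) has_real_derivative
        - deriv (\<lambda>y. a y t * p y t) x + 1/2 * (deriv ^^ 2) (\<lambda>y. b y t * p y t) x) (at t))"

definition diff_under_integral :: "(real \<Rightarrow> real \<Rightarrow> real) \<Rightarrow> real \<Rightarrow> bool" where
  "diff_under_integral f t \<longleftrightarrow>
     integrable lborel (\<lambda>x. deriv (\<lambda>s. f x s) t) \<and>
     ((\<lambda>s. \<integral>x. f x s \<partial>lborel) has_real_derivative (\<integral>x. deriv (\<lambda>s. f x s) t \<partial>lborel)) (at t)"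

text \<open>Integration by parts of \<open>u' v\<close> over the line has convergent integrals and zero boundary terms.\<close>

definition parts_vanish :: "(real \<Rightarrow> real) \<Rightarrow> (real \<Rightarrow> real) \<Rightarrow> bool" where
  "parts_vanish u v \<longleftrightarrow>
     integrable lborel (\<lambda>x. deriv u x * v x) \<and>
     integrable lborel (\<lambda>x. u x * deriv v x) \<and>
     ((\<lambda>x. u x * v x) \<longlongrightarrow> 0) at_top \<and>
     ((\<lambda>x. u x * v x) \<longlongrightarrow> 0) at_bot"

text \<open>
  The integrals, interchanges and boundary terms listed are those arising when \<open>-\<integral> p log p\<close> is
  differentiated in time along the Fokker--Planck equation and all derivatives are moved off \<open>p\<close>.
\<close>

definition regular_densities ::
  "(real \<Rightarrow> real \<Rightarrow> real) \<Rightarrow> (real \<Rightarrow> real \<Rightarrow> real) \<Rightarrow> (real \<Rightarrow> real \<Rightarrow> real) \<Rightarrow> bool" where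
  "regular_densities a b p \<longleftrightarrow>
     smooth_on (UNIV \<times> {0<..}) (\<lambda>(x, t). p x t) \<and>
     (\<forall>t>0.
       (\<forall>x. 0 < p x t) \<and>
       integrable lborel (\<lambda>x. p x t * ln (p x t)) \<and>
       integrable lborel (\<lambda>x. b x t * (deriv (\<lambda>y. p y t) x)\<^sup>2 / p x t) \<and>
       diff_under_integral p t \<and>
       diff_under_integral (\<lambda>x s. p x s * ln (p x s)) t \<and>
       parts_vanish (\<lambda>x. a x t * p x t) (\<lambda>x. ln (p x t)) \<and>
       parts_vanish (deriv (\<lambda>x. b x t * p x t)) (\<lambda>x. ln (p x t)) \<and>
       parts_vanish (\<lambda>x. a x t) (\<lambda>x. p x t) \<and>
       parts_vanish (deriv (\<lambda>x. b x t)) (\<lambda>x. p x t))"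

end

theory Submission
  imports Defs
begin

text \<open>
  Differentiating \<open>- \<integral> p log p\<close> under the integral sign gives \<open>- \<integral> p\<^sub>t log p\<close>, because
  \<open>\<integral> p\<^sub>t = 0\<close> by conservation of mass.  Inserting the Fokker--Planck equation for \<open>p\<^sub>t\<close> and
  integrating by parts once yields \<open>- \<integral> a p' + 1/2 \<integral> (b' p' + b p'\<^sup>2 / p)\<close>; a second integration
  by parts in the terms \<open>a p'\<close> and \<open>b' p'\<close> gives the claim.
\<close>

lemma Ck_on_imp_continuous_on:
  assumes "Ck_on n S f"
  shows "continuous_on S f"
  using assms
  by (cases n) (auto intro!: continuous_at_imp_continuous_on differentiable_imp_continuous_within)

text \<open>The derivative of the slice in direction \<open>v\<close> is the derivative of
  \<open>f\<close> in direction \<open>(v, 0)\<close>, evaluated along the same slice. The induction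
  therefore varies \<open>f\<close>: its hypothesis is applied to these directional
  derivatives.\<close>

lemma Ck_on_slice:
  fixes f :: "'a::real_normed_vector \<times> 'b::real_normed_vector \<Rightarrow> 'c::real_normed_vector"
  assumes "Ck_on n (UNIV \<times> T) f" and "t \<in> T"
  shows "Ck_on n UNIV (\<lambda>x. f (x, t))"
  using assms(1)
proof (induction n arbitrary: f)
  case 0
  then show ?case
    using assms(2) by (auto intro!: continuous_on_compose2[of "UNIV \<times> T" f] continuous_intros)
next
  case (Suc n)
  have D: "((\<lambda>x. f (x, t)) has_derivative (\<lambda>v. frechet_derivative f (at (x, t)) (v, 0))) (at x)" for x
  proof -
    have "(f has_derivative frechet_derivative f (at (x, t))) (at (x, t))"
      using Suc.prems assms(2) by (simp add: frechet_derivative_works)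
    moreover have "((\<lambda>x. (x, t)) has_derivative (\<lambda>v. (v, 0))) (at x)"
      by (auto intro!: derivative_eq_intros)
    ultimately show ?thesis
      using has_derivative_compose by fastforce
  qed
  have "frechet_derivative (\<lambda>x. f (x, t)) (at x) v = frechet_derivative f (at (x, t)) (v, 0)" for x v
    using frechet_derivative_at[OF D] by (metis (no_types, lifting))
  moreover have "Ck_on n UNIV (\<lambda>x. frechet_derivative f (at (x, t)) (v, 0))" for v
    using Suc.IH[of "\<lambda>z. frechet_derivative f (at z) (v, 0)"] Suc.prems by simp
  ultimately show ?case
    using differentiableI[OF D] by simp
qed

lemma smooth_on_slice:
  assumes "smooth_on (UNIV \<times> T) (\<lambda>(x, t). f x t)" and "t \<in> T"
  shows "smooth_on UNIV (\<lambda>x. f x t)"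
  using assms Ck_on_slice[of _ T "\<lambda>(x, t). f x t" t] by (simp add: smooth_on_def)

lemma smooth_on_DERIV_deriv:
  fixes f :: "real \<Rightarrow> real"
  assumes "smooth_on UNIV f"
  shows "(f has_real_derivative deriv f x) (at x)"
  using assms DERIV_deriv_iff_real_differentiable
  unfolding smooth_on_def by (metis Ck_on.simps(2) UNIV_I)

text \<open>On the real line \<open>deriv f\<close> is the directional derivative in direction 1, so
  order \<open>Suc n\<close> for \<open>f\<close> yields order \<open>n\<close> for
  \<open>deriv f\<close>.\<close>

lemma smooth_on_deriv:
  fixes f :: "real \<Rightarrow> real"
  assumes "smooth_on UNIV f"
  shows "smooth_on UNIV (deriv f)"
proof -
  have "frechet_derivative f (at x) 1 = deriv f x" for x
    using frechet_derivative_at[OF smooth_on_DERIV_deriv[OF assms, of x, unfolded has_field_derivative_def]]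
    by (metis mult.right_neutral)
  then have "deriv f = (\<lambda>x. frechet_derivative f (at x) 1)" by auto
  then show ?thesis
    using assms unfolding smooth_on_def by (metis Ck_on.simps(2))
qed

lemma smooth_on_isCont:
  assumes "smooth_on UNIV f"
  shows "isCont f x"
  using assms Ck_on_imp_continuous_on[of 0 UNIV f]
  by (simp add: smooth_on_def continuous_on_eq_continuous_at)

text \<open>The fundamental theorem of calculus on the whole line, applied to \<open>u * v\<close>:
  its derivative is a sum of two integrable terms, and its limits at both ends are 0. Continuity of
  the two derivatives is what this version of the theorem asks of the integrand.\<close>

lemma parts_vanish_integral:
  assumes "parts_vanish u v"
    and u: "\<And>x. (u has_real_derivative deriv u x) (at x)"
    and v: "\<And>x. (v has_real_derivative deriv v x) (at x)"
    and "\<And>x. isCont (deriv u) x" and "\<And>x. isCont (deriv v) x"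
  shows "(\<integral>x. deriv u x * v x \<partial>lborel) = - (\<integral>x. u x * deriv v x \<partial>lborel)"
proof -
  have int: "integrable lborel (\<lambda>x. deriv u x * v x)" "integrable lborel (\<lambda>x. u x * deriv v x)"
    and lim: "((\<lambda>x. u x * v x) \<longlongrightarrow> 0) at_top" "((\<lambda>x. u x * v x) \<longlongrightarrow> 0) at_bot"
    using assms(1) by (auto simp: parts_vanish_def)
  have "(LBINT x=-\<infinity>..\<infinity>. deriv u x * v x + u x * deriv v x) = 0 - 0"
  proof (rule interval_integral_FTC_integrable[where F = "\<lambda>x. u x * v x"])
    show "((\<lambda>x. u x * v x) has_vector_derivative deriv u x * v x + u x * deriv v x) (at x)" for x
      unfolding has_real_derivative_iff_has_vector_derivative[symmetric]
      by (auto intro!: derivative_eq_intros u v)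
    show "isCont (\<lambda>x. deriv u x * v x + u x * deriv v x) x" for x
      using assms(4,5) DERIV_isCont[OF u] DERIV_isCont[OF v] by (intro continuous_intros)
    show "set_integrable lborel (einterval (-\<infinity>) \<infinity>) (\<lambda>x. deriv u x * v x + u x * deriv v x)"
      using int by (simp add: set_integrable_def)
    show "(((\<lambda>x. u x * v x) \<circ> real_of_ereal) \<longlongrightarrow> 0) (at_right (-\<infinity>))"
      using lim(2) by (simp add: ereal_tendsto_simps)
    show "(((\<lambda>x. u x * v x) \<circ> real_of_ereal) \<longlongrightarrow> 0) (at_left \<infinity>)"
      using lim(1) by (simp add: ereal_tendsto_simps)
  qed simp
  then show ?thesis
    using int by (simp add: interval_lebesgue_integral_def set_lebesgue_integral_def)
qed

text \<open>The spatial part of the computation at one frozen time, with \<alpha>, \<beta>,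
  \<open>q\<close> standing for the slices of \<open>a\<close>, \<open>b\<close>, \<open>p\<close>.
  For \<beta> only two derivatives and continuity of the second are assumed, since it will be the
  square of a smooth function and these facts then follow by direct computation.\<close>

lemma fokker_planck_entropy_integral:
  fixes \<alpha> \<beta> q :: "real \<Rightarrow> real"
  assumes smooth: "smooth_on UNIV \<alpha>" "smooth_on UNIV q"
    and \<beta>: "\<And>x. (\<beta> has_real_derivative deriv \<beta> x) (at x)"
    and \<beta>': "\<And>x. (deriv \<beta> has_real_derivative deriv (deriv \<beta>) x) (at x)"
    and \<beta>'': "\<And>x. isCont (deriv (deriv \<beta>)) x"
    and pos: "\<And>x. 0 < q x"
    and fisher: "integrable lborel (\<lambda>x. \<beta> x * (deriv q x)\<^sup>2 / q x)"
    and parts: "parts_vanish (\<lambda>x. \<alpha> x * q x) (\<lambda>x. ln (q x))"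
      "parts_vanish (deriv (\<lambda>x. \<beta> x * q x)) (\<lambda>x. ln (q x))"
      "parts_vanish \<alpha> q" "parts_vanish (deriv \<beta>) q"
  shows "(\<integral>x. (- deriv (\<lambda>x. \<alpha> x * q x) x + 1/2 * (deriv ^^ 2) (\<lambda>x. \<beta> x * q x) x) * ln (q x) \<partial>lborel)
    = - (1/2 * (\<integral>x. \<beta> x * (deriv q x)\<^sup>2 / q x \<partial>lborel)
      + (\<integral>x. deriv \<alpha> x * q x \<partial>lborel) - 1/2 * (\<integral>x. deriv (deriv \<beta>) x * q x \<partial>lborel))"
proof -
  note \<alpha> = smooth_on_DERIV_deriv[OF smooth(1)]
  note q = smooth_on_DERIV_deriv[OF smooth(2)]
  note q' = smooth_on_DERIV_deriv[OF smooth_on_deriv[OF smooth(2)]]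
  note cont = DERIV_isCont[OF \<alpha>] DERIV_isCont[OF q] DERIV_isCont[OF q'] DERIV_isCont[OF \<beta>]
    DERIV_isCont[OF \<beta>'] \<beta>'' smooth_on_isCont[OF smooth_on_deriv[OF smooth(1)]]
    smooth_on_isCont[OF smooth_on_deriv[OF smooth_on_deriv[OF smooth(2)]]]
  have nz: "q x \<noteq> 0" for x using pos[of x] by simp
  let ?u = "\<lambda>x. \<alpha> x * q x" and ?w = "\<lambda>x. \<beta> x * q x" and ?l = "\<lambda>x. ln (q x)"
  have u: "(?u has_real_derivative deriv \<alpha> x * q x + \<alpha> x * deriv q x) (at x)" for x
    by (auto intro!: derivative_eq_intros \<alpha> q)
  have w: "(?w has_real_derivative deriv \<beta> x * q x + \<beta> x * deriv q x) (at x)" for x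
    by (auto intro!: derivative_eq_intros \<beta> q)
  have l: "(?l has_real_derivative deriv q x / q x) (at x)" for x
    using nz pos by (auto intro!: derivative_eq_intros q simp: field_simps)
  have u': "deriv ?u = (\<lambda>x. deriv \<alpha> x * q x + \<alpha> x * deriv q x)"
    using DERIV_imp_deriv[OF u] by auto
  have w': "deriv ?w = (\<lambda>x. deriv \<beta> x * q x + \<beta> x * deriv q x)"
    using DERIV_imp_deriv[OF w] by auto
  have l': "deriv ?l = (\<lambda>x. deriv q x / q x)"
    using DERIV_imp_deriv[OF l] by auto
  \<comment> \<open>The expanded second derivative serves only to supply differentiability of
    \<open>deriv ?w\<close> and continuity of \<open>deriv (deriv ?w)\<close> for the integration by
    parts; its terms are never integrated separately.\<close>
  have ww: "(deriv ?w has_real_derivative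
      deriv (deriv \<beta>) x * q x + 2 * (deriv \<beta> x * deriv q x) + \<beta> x * deriv (deriv q) x) (at x)" for x
    unfolding w' by (auto intro!: derivative_eq_intros \<beta> \<beta>' q q' simp: algebra_simps)
  have w'': "deriv (deriv ?w) = (\<lambda>x. deriv (deriv \<beta>) x * q x + 2 * (deriv \<beta> x * deriv q x)
      + \<beta> x * deriv (deriv q) x)"
    using DERIV_imp_deriv[OF ww] by auto
  have cl: "isCont (deriv ?l) x" for x
    unfolding l' using nz cont by (intro continuous_intros) auto
  \<comment> \<open>Splitting an integral of a sum requires integrable summands, because a divergent
    Bochner integral has the default value 0. The third fact comes from the boundary condition on
    \<open>deriv \<beta>\<close> and \<open>q\<close>.\<close>
  have int: "integrable lborel (\<lambda>x. deriv ?u x * ?l x)"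
    "integrable lborel (\<lambda>x. deriv (deriv ?w) x * ?l x)"
    "integrable lborel (\<lambda>x. deriv \<beta> x * deriv q x)"
    using parts by (auto simp: parts_vanish_def)
  have 1: "(\<integral>x. deriv ?u x * ?l x \<partial>lborel) = (\<integral>x. deriv \<alpha> x * q x \<partial>lborel)"
  proof -
    have "(\<integral>x. deriv ?u x * ?l x \<partial>lborel) = - (\<integral>x. ?u x * deriv ?l x \<partial>lborel)"
      using parts(1)
    proof (rule parts_vanish_integral)
      show "isCont (deriv ?u) x" for x
        unfolding u' using cont by (intro continuous_intros) auto
    qed (use cl u l in \<open>simp_all add: u' l'\<close>)
    also have "(\<integral>x. ?u x * deriv ?l x \<partial>lborel) = (\<integral>x. \<alpha> x * deriv q x \<partial>lborel)"
      using nz by (simp add: l')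
    also have "- \<dots> = (\<integral>x. deriv \<alpha> x * q x \<partial>lborel)"
      using parts_vanish_integral[OF parts(3) \<alpha> q] cont by simp
    finally show ?thesis .
  qed
  have 2: "(\<integral>x. deriv (deriv ?w) x * ?l x \<partial>lborel)
      = (\<integral>x. deriv (deriv \<beta>) x * q x \<partial>lborel) - (\<integral>x. \<beta> x * (deriv q x)\<^sup>2 / q x \<partial>lborel)"
  proof -
    have "(\<integral>x. deriv (deriv ?w) x * ?l x \<partial>lborel) = - (\<integral>x. deriv ?w x * deriv ?l x \<partial>lborel)"
      using parts(2)
    proof (rule parts_vanish_integral)
      show "isCont (deriv (deriv ?w)) x" for x
        unfolding w'' using cont by (intro continuous_intros) auto
      show "(deriv ?w has_real_derivative deriv (deriv ?w) x) (at x)" for x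
        using ww[of x] by (simp add: w'')
    qed (use cl l in \<open>simp_all add: l'\<close>)
    \<comment> \<open>Since the logarithmic derivative is \<open>deriv q x / q x\<close>, the factor
      \<open>q\<close> cancels in the first term of \<open>deriv ?w\<close>, while the second term
      becomes the Fisher integrand.\<close>
    also have "(\<lambda>x. deriv ?w x * deriv ?l x) = (\<lambda>x. deriv \<beta> x * deriv q x + \<beta> x * (deriv q x)\<^sup>2 / q x)"
      using nz by (auto simp: w' l' field_simps power2_eq_square)
    also have "- integral\<^sup>L lborel \<dots>
        = - (\<integral>x. deriv \<beta> x * deriv q x \<partial>lborel) - (\<integral>x. \<beta> x * (deriv q x)\<^sup>2 / q x \<partial>lborel)"
      using int fisher by simp
    also have "- (\<integral>x. deriv \<beta> x * deriv q x \<partial>lborel) = (\<integral>x. deriv (deriv \<beta>) x * q x \<partial>lborel)"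
      using parts_vanish_integral[OF parts(4) \<beta>' q] cont by simp
    finally show ?thesis .
  qed
  have "(\<integral>x. (- deriv ?u x + 1/2 * (deriv ^^ 2) ?w x) * ?l x \<partial>lborel)
      = (\<integral>x. 1/2 * (deriv (deriv ?w) x * ?l x) - deriv ?u x * ?l x \<partial>lborel)"
    by (simp add: numeral_2_eq_2 algebra_simps)
  also have "\<dots> = 1/2 * (\<integral>x. deriv (deriv ?w) x * ?l x \<partial>lborel) - (\<integral>x. deriv ?u x * ?l x \<partial>lborel)"
    using int by simp
  finally show ?thesis
    unfolding 1 2 by simp
qed

theorem theorem5:
  fixes M :: "'a measure" and F :: "real \<Rightarrow> 'a measure"
    and W X :: "real \<Rightarrow> 'a \<Rightarrow> real"
    and a \<sigma> b p :: "real \<Rightarrow> real \<Rightarrow> real" and t :: real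
  assumes "prob_space M"
    and "brownian_motion M F W"
    and "continuous_on (UNIV \<times> {0..}) (\<lambda>(x, t). a x t)"
    and "smooth_on (UNIV \<times> {0<..}) (\<lambda>(x, t). a x t)"
    and "continuous_on (UNIV \<times> {0..}) (\<lambda>(x, t). \<sigma> x t)"
    and "smooth_on (UNIV \<times> {0<..}) (\<lambda>(x, t). \<sigma> x t)"
    and "\<And>x t. 0 \<le> t \<Longrightarrow> 0 < \<sigma> x t"
    and "\<And>x t. b x t = (\<sigma> x t)\<^sup>2"
    and "sde_solution M F W a \<sigma> X"
    and "\<And>t. 0 < t \<Longrightarrow> distributed M lborel (X t) (\<lambda>x. ennreal (p x t))"
    and "fokker_planck a b p"
    and "regular_densities a b p"
    and "0 < t"
  shows "((\<lambda>s. prob_space.entropy M (exp 1) lborel (X s)) has_real_derivative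
      1/2 * fisher_information M (\<lambda>x. b x t) (\<lambda>x. p x t) (X t)
      + prob_space.expectation M (\<lambda>\<omega>. deriv (\<lambda>x. a x t) (X t \<omega>)
          - 1/2 * (deriv ^^ 2) (\<lambda>x. b x t) (X t \<omega>))) (at t)"
proof -
  interpret prob_space M by fact
  note reg = assms(12)[unfolded regular_densities_def]
  have pos: "0 < p x s" if "0 < s" for x s using reg that by blast
  have p: "smooth_on UNIV (\<lambda>x. p x t)" and a: "smooth_on UNIV (\<lambda>x. a x t)"
    and s: "smooth_on UNIV (\<lambda>x. \<sigma> x t)"
    using reg assms(4,6,13) by (auto intro: smooth_on_slice)
  have b_eq: "(\<lambda>x. b x t) = (\<lambda>x. (\<sigma> x t)\<^sup>2)"
    using assms(8) by simp
  \<comment> \<open>The first two spatial derivatives of \<open>b\<close> are computed from those of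
    its smooth square root \<sigma>, which gives exactly the regularity demanded of \<beta>
    above.\<close>
  let ?s1 = "deriv (\<lambda>x. \<sigma> x t)"
  let ?s2 = "deriv ?s1"
  note s0 = smooth_on_DERIV_deriv[OF s]
  note s1 = smooth_on_DERIV_deriv[OF smooth_on_deriv[OF s]]
  have b1: "((\<lambda>x. b x t) has_real_derivative 2 * \<sigma> x t * ?s1 x) (at x)" for x
    unfolding b_eq by (auto intro!: derivative_eq_intros s0)
  have b1': "deriv (\<lambda>x. b x t) = (\<lambda>x. 2 * \<sigma> x t * ?s1 x)"
    using DERIV_imp_deriv[OF b1] by auto
  have b2: "(deriv (\<lambda>x. b x t) has_real_derivative 2 * (?s1 x)\<^sup>2 + 2 * \<sigma> x t * ?s2 x) (at x)" for x
    unfolding b1' by (auto intro!: derivative_eq_intros s0 s1 simp: power2_eq_square)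
  have b2': "deriv (deriv (\<lambda>x. b x t)) = (\<lambda>x. 2 * (?s1 x)\<^sup>2 + 2 * \<sigma> x t * ?s2 x)"
    using DERIV_imp_deriv[OF b2] by auto
  have b2c: "isCont (deriv (deriv (\<lambda>x. b x t))) x" for x
    unfolding b2' using s smooth_on_deriv smooth_on_isCont
    by (intro continuous_intros) blast+

  let ?G = "\<lambda>x. - deriv (\<lambda>y. a y t * p y t) x + 1/2 * (deriv ^^ 2) (\<lambda>y. b y t * p y t) x"
  have pt: "((\<lambda>s. p x s) has_real_derivative ?G x) (at t)" for x
    using assms(11,13) by (simp add: fokker_planck_def)
  have pt': "deriv (\<lambda>s. p x s) t = ?G x" for x
    using DERIV_imp_deriv[OF pt] .
  \<comment> \<open>The product rule gives the extra term \<open>p * (?G x / p)\<close>, which is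
    \<open>?G x\<close> by positivity of the density.\<close>
  have plnp: "deriv (\<lambda>s. p x s * ln (p x s)) t = ?G x * ln (p x t) + ?G x" for x
    by (rule DERIV_imp_deriv)
      (use pos[OF \<open>0 < t\<close>, of x] in \<open>auto intro!: derivative_eq_intros pt simp: field_simps\<close>)
  have "diff_under_integral p t"
    and diff: "diff_under_integral (\<lambda>x s. p x s * ln (p x s)) t"
    using reg assms(13) by auto
  then have G_int: "integrable lborel ?G"
    and G: "((\<lambda>s. \<integral>x. p x s \<partial>lborel) has_real_derivative (\<integral>x. ?G x \<partial>lborel)) (at t)"
    by (simp_all add: diff_under_integral_def pt')
  have mass: "(\<integral>x. p x s \<partial>lborel) = 1" if "0 < s" for s
    using distributed_integral[OF assms(10)[OF that], of "\<lambda>_. 1"] less_imp_le[OF pos[OF that]] prob_space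
    by simp
  \<comment> \<open>The total mass is known to be 1 only at positive times. These form an open set
    containing \<open>t\<close>, so the mass has derivative 0 there, and uniqueness of the
    derivative identifies this with the integral of \<open>?G\<close>.\<close>
  have G0: "(\<integral>x. ?G x \<partial>lborel) = 0"
  proof (rule DERIV_unique[OF G])
    show "((\<lambda>s. \<integral>x. p x s \<partial>lborel) has_real_derivative 0) (at t)"
      by (rule has_field_derivative_transform_within_open[where f = "\<lambda>_. 1" and S = "{0<..}"])
        (use mass \<open>0 < t\<close> in auto)
  qed
  \<comment> \<open>Differentiation under the integral sign provides integrability only of the sum
    with \<open>?G\<close>; subtracting the integrable \<open>?G\<close> isolates the logarithmic
    term.\<close>
  have Gl_int: "integrable lborel (\<lambda>x. ?G x * ln (p x t))"
  proof -
    have "integrable lborel (\<lambda>x. ?G x * ln (p x t) + ?G x)"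
      using diff by (simp add: diff_under_integral_def plnp)
    from Bochner_Integration.integrable_diff[OF this G_int] show ?thesis by simp
  qed
  have "((\<lambda>s. \<integral>x. p x s * ln (p x s) \<partial>lborel) has_real_derivative
      (\<integral>x. ?G x * ln (p x t) + ?G x \<partial>lborel)) (at t)"
    using diff by (simp only: diff_under_integral_def plnp)
  also have "(\<integral>x. ?G x * ln (p x t) + ?G x \<partial>lborel) = (\<integral>x. ?G x * ln (p x t) \<partial>lborel)"
    using Bochner_Integration.integral_add[OF Gl_int G_int] G0 by simp
  also have "\<dots> = - (1/2 * (\<integral>x. b x t * (deriv (\<lambda>x. p x t) x)\<^sup>2 / p x t \<partial>lborel)
      + (\<integral>x. deriv (\<lambda>x. a x t) x * p x t \<partial>lborel)
      - 1/2 * (\<integral>x. deriv (deriv (\<lambda>x. b x t)) x * p x t \<partial>lborel))"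
  proof (rule fokker_planck_entropy_integral)
    show "((\<lambda>x. b x t) has_real_derivative deriv (\<lambda>x. b x t) x) (at x)" for x
      using b1 by (simp add: b1')
    show "(deriv (\<lambda>x. b x t) has_real_derivative deriv (deriv (\<lambda>x. b x t)) x) (at x)" for x
      using b2 unfolding b2' by simp
  qed (use a p b2c pos reg \<open>0 < t\<close> in blast)+
  finally have D: "((\<lambda>s. - (\<integral>x. p x s * ln (p x s) \<partial>lborel)) has_real_derivative
      1/2 * (\<integral>x. b x t * (deriv (\<lambda>x. p x t) x)\<^sup>2 / p x t \<partial>lborel)
      + (\<integral>x. deriv (\<lambda>x. a x t) x * p x t \<partial>lborel)
      - 1/2 * (\<integral>x. deriv (deriv (\<lambda>x. b x t)) x * p x t \<partial>lborel)) (at t)"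
    by (auto dest: DERIV_minus)

  have meas: "f \<in> borel_measurable lborel" if "\<And>x. isCont f x" for f :: "real \<Rightarrow> real"
    using that by (simp add: borel_measurable_continuous_onI continuous_at_imp_continuous_on)
  \<comment> \<open>The change of variables to the law of \<open>X t\<close> holds for every
    measurable \<open>f\<close>, integrable or not, so continuity of the integrands below suffices
    to rewrite all expectations as integrals against \<open>p\<close>.\<close>
  have expect: "expectation (\<lambda>\<omega>. f (X t \<omega>)) = (\<integral>x. p x t * f x \<partial>lborel)"
    if "f \<in> borel_measurable lborel" for f :: "real \<Rightarrow> real"
    using distributed_integral[OF assms(10)[OF \<open>0 < t\<close>] that] less_imp_le[OF pos[OF \<open>0 < t\<close>]] by simp
  note a1c = smooth_on_isCont[OF smooth_on_deriv[OF a]]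
  have lnp: "deriv (\<lambda>x. ln (p x t)) = (\<lambda>x. deriv (\<lambda>x. p x t) x / p x t)"
  proof
    show "deriv (\<lambda>x. ln (p x t)) x = deriv (\<lambda>x. p x t) x / p x t" for x
      by (rule DERIV_imp_deriv)
        (use pos[OF \<open>0 < t\<close>, of x] in
          \<open>auto intro!: derivative_eq_intros smooth_on_DERIV_deriv[OF p] simp: field_simps\<close>)
  qed
  have fisher: "fisher_information M (\<lambda>x. b x t) (\<lambda>x. p x t) (X t)
      = (\<integral>x. b x t * (deriv (\<lambda>x. p x t) x)\<^sup>2 / p x t \<partial>lborel)"
  proof -
    have nz: "p x t \<noteq> 0" for x using pos[OF \<open>0 < t\<close>, of x] by simp
    have "isCont (\<lambda>x. b x t * (deriv (\<lambda>x. ln (p x t)) x)\<^sup>2) x" for x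
      unfolding lnp using DERIV_isCont[OF b1] smooth_on_isCont[OF p] smooth_on_isCont[OF smooth_on_deriv[OF p]] nz
      by (intro continuous_intros) auto
    \<comment> \<open>Weighting the squared logarithmic derivative by \<open>p\<close> cancels one
      of the two factors \<open>p\<close> in its denominator.\<close>
    from expect[OF meas[OF this]] show ?thesis
      unfolding fisher_information_def lnp using nz
      by (auto simp: power2_eq_square field_simps intro!: Bochner_Integration.integral_cong)
  qed
  have int: "integrable lborel (\<lambda>x. deriv (\<lambda>x. a x t) x * p x t)"
    "integrable lborel (\<lambda>x. deriv (deriv (\<lambda>x. b x t)) x * p x t)"
    using reg \<open>0 < t\<close> by (auto simp: parts_vanish_def)
  have "expectation (\<lambda>\<omega>. deriv (\<lambda>x. a x t) (X t \<omega>) - 1/2 * (deriv ^^ 2) (\<lambda>x. b x t) (X t \<omega>))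
      = (\<integral>x. p x t * (deriv (\<lambda>x. a x t) x - 1/2 * deriv (deriv (\<lambda>x. b x t)) x) \<partial>lborel)"
    unfolding numeral_2_eq_2 funpow.simps comp_def id_def
    by (rule expect, rule meas, intro continuous_intros a1c b2c)
  also have "\<dots> = (\<integral>x. deriv (\<lambda>x. a x t) x * p x t
      - 1/2 * (deriv (deriv (\<lambda>x. b x t)) x * p x t) \<partial>lborel)"
    by (simp add: algebra_simps)
  also have "\<dots> = (\<integral>x. deriv (\<lambda>x. a x t) x * p x t \<partial>lborel)
      - 1/2 * (\<integral>x. deriv (deriv (\<lambda>x. b x t)) x * p x t \<partial>lborel)"
    using int by simp
  finally have drift: "expectation (\<lambda>\<omega>. deriv (\<lambda>x. a x t) (X t \<omega>) - 1/2 * (deriv ^^ 2) (\<lambda>x. b x t) (X t \<omega>))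
      = \<dots>" .
  show ?thesis
    unfolding fisher drift add_diff_eq
    \<comment> \<open>A density is given only for positive times, so the entropy agrees with the
      differentiated integral on \<open>{0<..}\<close>. This open neighbourhood of \<open>t\<close>
      is enough to transfer the derivative.\<close>
    by (rule has_field_derivative_transform_within_open[OF D, where S = "{0<..}"])
      (use \<open>0 < t\<close> entropy_eq_integral_density[OF assms(10)] pos in \<open>auto simp: less_imp_le\<close>)
qed

end
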